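(* Let $W:[0,1]^d\times[0,1]^d\to[0,1]$ be a graphon on $[0,1]^d$ (with Lebesgue measure) that is Hölder$(\alpha)$ for some $d\ge 2$ and $\alpha\in(0,1]$. Then there exists a graphon on $[0,1]$ (with Lebesgue measure) that is equivalent to $W$ and is Hölder$(\alpha/d)$. In particular, if $W$ is differentiable, or just Lipschitz, then there exists a graphon on $[0,1]$ that is equivalent to $W$ and is Hölder$(1/d)$.
   Context: A graphon on a probability space $(\mathcal S,\mathcal F,\mu)$ is a symmetric measurable function $W:\mathcal S^2\to[0,1]$. The spaces $[0,1]$ and $[0,1]^d$ ($d$ an integer) are regarded as probability spaces with Lebesgue measure. Equivalence: two graphons $W_1$ on $(\mathcal S_1,\mu_1)$ and $W_2$ on $(\mathcal S_2,\mu_2)$ (possibly different probability spaces) are equivalent (weakly isomorphic) if $t(F,W_1)=t(F,W_2)$ for every finite simple graph $F$, where $t(F,W)=\int_{\mathcal S^{V(F)}}\prod_{ij\in E(F)}W(x_i,x_j)\prod_{i\in V(F)}d\mu(x_i)$. Hölder continuity: for $\alpha\in(0,1]$, a real function $f$ on a subset $D$ of a Euclidean space is Hölder$(\alpha)$ if there is a constant $C<\infty$ with $|f(x)-f(y)|\le C|x-y|^\alpha$ for all $x,y\in D$; Lipschitz means Hölder$(1)$. A graphon on $[0,1]^d$ is regarded as a function on $[0,1]^{2d}\subset\mathbb R^{2d}$ for this purpose.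
   Formalization: "Differentiable" is taken to mean differentiable on the closed cube with bounded derivative (this includes continuously differentiable); for mere pointwise differentiability, which does not imply Lipschitz, the claim is false. *)

theory Defs
  imports "HOL-Analysis.Analysis" "HOL-Probability.Probability"
begin

text \<open>A graphon is written uncurried, as a function on pairs; its values off
  \<open>space M \<times> space M\<close> are irrelevant.\<close>

definition graphon :: "'a measure \<Rightarrow> ('a \<times> 'a \<Rightarrow> real) \<Rightarrow> bool" where
  "graphon M W \<longleftrightarrow>
     prob_space M \<and>
     W \<in> borel_measurable (M \<Otimes>\<^sub>M M) \<and>
     (\<forall>x\<in>space M. \<forall>y\<in>space M. W (x, y) = W (y, x)) \<and>
     (\<forall>x\<in>space M. \<forall>y\<in>space M. W (x, y) \<in> {0..1})"

definition finite_simple_graph :: "'v set \<Rightarrow> 'v set set \<Rightarrow> bool" where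
  "finite_simple_graph V E \<longleftrightarrow> finite V \<and> (\<forall>e\<in>E. e \<subseteq> V \<and> card e = 2)"

text \<open>The homomorphism density \<open>t(F,W)\<close> of \<open>F = (V,E)\<close>.  An edge \<open>e = {i,j}\<close> is unordered, so
  its end points are enumerated in increasing order; by symmetry of \<open>W\<close> the order is immaterial
  (see \<open>edge_factor\<close> below).\<close>

definition hom_density ::
    "nat set \<Rightarrow> nat set set \<Rightarrow> 'a measure \<Rightarrow> ('a \<times> 'a \<Rightarrow> real) \<Rightarrow> real" where
  "hom_density V E M W = (\<integral>x. (\<Prod>e\<in>E. W (x (Min e), x (Max e))) \<partial>(\<Pi>\<^sub>M i\<in>V. M))"

lemma edge_factor:
  fixes i j :: nat
  assumes "graphon M W" "i \<in> V" "j \<in> V" "x \<in> space (\<Pi>\<^sub>M i\<in>V. M)"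
  shows "W (x (Min {i, j}), x (Max {i, j})) = W (x i, x j)"
proof -
  have "x i \<in> space M" "x j \<in> space M"
    using assms by (auto simp: space_PiM PiE_def)
  then show ?thesis
    using assms(1) by (auto simp: graphon_def min_def max_def)
qed

text \<open>Weak isomorphism.  Every finite simple graph is isomorphic to one whose vertices are natural
  numbers, so it suffices to let \<open>F\<close> range over those.\<close>

definition graphon_equivalent ::
    "'a measure \<Rightarrow> ('a \<times> 'a \<Rightarrow> real) \<Rightarrow> 'b measure \<Rightarrow> ('b \<times> 'b \<Rightarrow> real) \<Rightarrow> bool" where
  "graphon_equivalent M\<^sub>1 W\<^sub>1 M\<^sub>2 W\<^sub>2 \<longleftrightarrow>
     (\<forall>(V :: nat set) E. finite_simple_graph V E \<longrightarrow>
        hom_density V E M\<^sub>1 W\<^sub>1 = hom_density V E M\<^sub>2 W\<^sub>2)"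

text \<open>On a product type \<open>dist\<close> is the Euclidean distance of the product space, so that
  \<open>(real ^ 'd) \<times> (real ^ 'd)\<close> carries the metric of \<open>2d\<close>-dimensional Euclidean space.\<close>

definition holder_on :: "real \<Rightarrow> 'a::euclidean_space set \<Rightarrow> ('a \<Rightarrow> real) \<Rightarrow> bool" where
  "holder_on \<alpha> D f \<longleftrightarrow> (\<exists>C. \<forall>x\<in>D. \<forall>y\<in>D. \<bar>f x - f y\<bar> \<le> C * dist x y powr \<alpha>)"

lemma holder_on_1_iff_lipschitz: "holder_on 1 D f \<longleftrightarrow> (\<exists>C. C-lipschitz_on D f)"
proof
  assume "holder_on 1 D f"
  then obtain C where C: "\<And>x y. x \<in> D \<Longrightarrow> y \<in> D \<Longrightarrow> \<bar>f x - f y\<bar> \<le> C * dist x y"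
    by (auto simp: holder_on_def)
  have "\<bar>C\<bar>-lipschitz_on D f"
  proof (rule lipschitz_onI)
    fix x y assume "x \<in> D" "y \<in> D"
    then have "\<bar>f x - f y\<bar> \<le> C * dist x y" by (rule C)
    also have "\<dots> \<le> \<bar>C\<bar> * dist x y" by (intro mult_right_mono) auto
    finally show "dist (f x) (f y) \<le> \<bar>C\<bar> * dist x y" by (simp add: dist_real_def)
  qed simp
  then show "\<exists>C. C-lipschitz_on D f" ..
qed (auto simp: holder_on_def lipschitz_on_def dist_real_def)

text \<open>Differentiability of \<open>f\<close> on \<open>D\<close>, one-sided at the boundary, with a bounded derivative.
  Every \<open>C\<^sup>1\<close> function on a compact \<open>D\<close> qualifies.  Without the bound, differentiability
  would not imply the Lipschitz condition on a cube.\<close>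

definition boundedly_differentiable_on ::
    "'a::euclidean_space set \<Rightarrow> ('a \<Rightarrow> real) \<Rightarrow> bool" where
  "boundedly_differentiable_on D f \<longleftrightarrow>
     (\<exists>f'. (\<forall>x\<in>D. (f has_derivative f' x) (at x within D)) \<and>
           (\<exists>B. \<forall>x\<in>D. onorm (f' x) \<le> B))"

definition unit_interval :: "real measure" where
  "unit_interval = restrict_space lborel {0..1}"

definition unit_cube :: "(real ^ 'd) measure" where
  "unit_cube = restrict_space lborel {x. \<forall>i. x $ i \<in> {0..1}}"

lemma space_unit_interval: "space unit_interval = {0..1}"
  by (simp add: unit_interval_def space_restrict_space)

lemma space_unit_cube: "space unit_cube = {x :: real ^ 'd. \<forall>i. x $ i \<in> {0..1}}"
  by (simp add: unit_cube_def space_restrict_space)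

lemma prob_space_unit_interval: "prob_space unit_interval"
  unfolding unit_interval_def by (intro prob_space_restrict_space) auto

lemma prob_space_unit_cube: "prob_space (unit_cube :: (real ^ 'd) measure)"
proof -
  have eq: "{x :: real ^ 'd. \<forall>i. x $ i \<in> {0..1}} = cbox 0 1"
    by (auto simp: mem_box_cart)
  have "emeasure lborel (cbox 0 (1 :: real ^ 'd)) = 1"
    by (subst emeasure_lborel_cbox) (auto simp: Basis_vec_def inner_axis intro!: prod.neutral)
  then show ?thesis
    unfolding unit_cube_def eq by (intro prob_space_restrict_space) auto
qed

end

theory Submission
  imports Defs
begin

text \<open>
  Let \<open>\<phi>\<close> be the \<open>d\<close>-dimensional Peano curve.  At level \<open>n\<close> it maps the \<open>3 ^ (d * n)\<close> consecutive
  intervals of length \<open>3 ^ (- d * n)\<close> bijectively to the grid cubes of side \<open>3 ^ (- n)\<close>, and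
  neighbouring intervals to neighbouring cubes; hence \<open>\<phi>\<close> is Hoelder of exponent \<open>1 / d\<close>.  The level
  \<open>n\<close> approximation of \<open>\<phi>\<close> has the same distribution as rounding a uniform point of the cube to the
  grid, and in the limit \<open>\<phi>\<close> is measure preserving.  Therefore \<open>V (x, y) = W (\<phi> x, \<phi> y)\<close> has the
  homomorphism densities of \<open>W\<close>, and the Hoelder exponents multiply.
\<close>

section \<open>The reflected ternary code\<close>

text \<open>
  \<open>peano c m k\<close> is the \<open>k\<close>-th grid point of the \<open>m\<close>-th approximation.  The \<open>m\<close>-th ternary digit
  of the parameter becomes a digit of the coordinate \<open>c m\<close>, reflected if the other coordinates have
  odd sum.  This is Peano's rule, which uses the parity of the digits spent on the other coordinates:
  an integer has the parity of its ternary digit sum, and reflection preserves parity.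
\<close>

primrec peano :: "(nat \<Rightarrow> 'd) \<Rightarrow> nat \<Rightarrow> nat \<Rightarrow> 'd::finite \<Rightarrow> int" where
  "peano c 0 k = (\<lambda>_. 0)"
| "peano c (Suc m) k = (let q = peano c m (k div 3) in
     q(c m := 3 * q (c m) +
       (if even (\<Sum>j\<in>- {c m}. q j) then int (k mod 3) else 2 - int (k mod 3))))"

text \<open>Coordinates are refined one at a time, so after \<open>m\<close> digits the cells are
  boxes whose side in direction \<open>i\<close> is \<open>1 / 3 ^ depth c m i\<close>.\<close>

primrec depth :: "(nat \<Rightarrow> 'd) \<Rightarrow> nat \<Rightarrow> 'd \<Rightarrow> nat" where
  "depth c 0 i = 0"
| "depth c (Suc m) i = depth c m i + (if c m = i then 1 else 0)"

text \<open>The sign of the step is part of the statement because the induction needs it: when the step is in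
  the coordinate that receives the next digit, the digits of the two neighbours match up only if
  the step has the direction in which that digit is traversed.\<close>

lemma peano_Suc_index:
  assumes "Suc k < 3 ^ m"
  shows "\<exists>i. peano c m (Suc k) =
    (peano c m k)(i := peano c m k i + (if even (\<Sum>j\<in>- {i}. peano c m k j) then 1 else - 1))"
  using assms
proof (induction m arbitrary: k)
  case 0
  then show ?case by simp
next
  case (Suc m)
  define q where "q = peano c m (k div 3)"
  define q' where "q' = peano c m (Suc k div 3)"
  have up: "(\<Sum>j\<in>- {i}. (f(i := x)) j) = (\<Sum>j\<in>- {i}. f j)" for f :: "'a \<Rightarrow> int" and i x
    by (rule sum.cong) auto
  show ?case
  proof (cases "k mod 3 = 2")
    \<comment> \<open>Both indices have the same parent, so only the last digit moves, in the
      direction fixed by the parity.\<close>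
    case False
    then have "Suc k div 3 = k div 3" and "Suc k mod 3 = Suc (k mod 3)"
      by presburger+
    then show ?thesis
      by (intro exI[of _ "c m"]) (auto simp: Let_def up fun_eq_iff)
  next
    \<comment> \<open>A carry: \<open>k\<close> has the last digit under its parent,
      \<open>Suc k\<close> the first one under the next parent.\<close>
    case True
    then have div: "Suc k div 3 = Suc (k div 3)" and mod: "Suc k mod 3 = 0"
      by presburger+
    have "Suc (k div 3) < 3 ^ m"
      using Suc.prems div by (metis less_mult_imp_div_less mult.commute power_Suc)
    from Suc.IH[OF this] obtain i where i:
      "q' = q(i := q i + (if even (\<Sum>j\<in>- {i}. q j) then 1 else - 1))"
      unfolding q_def q'_def div by blast
    show ?thesis
    proof (cases "i = c m")
      \<comment> \<open>Both parents traverse the new digit in the same direction: the step between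
        the parents contributes 3 or -3, the return of the digit -2 or 2, which leaves 1 or
        -1.\<close>
      case True
      have "(\<Sum>j\<in>- {c m}. q' j) = (\<Sum>j\<in>- {c m}. q j)"
        unfolding i True by (rule up)
      then show ?thesis
        using i True mod \<open>k mod 3 = 2\<close>
        by (intro exI[of _ i]) (auto simp: Let_def up fun_eq_iff simp flip: q_def q'_def)
    next
      case False
      have split_sum: "(\<Sum>j\<in>- {a}. f j) = f b + (\<Sum>j\<in>- {a} - {b}. f j)" if "a \<noteq> b"
        for f :: "'a \<Rightarrow> int" and a b
        using that by (subst sum.remove[of _ b]) auto
      \<comment> \<open>A unit step in coordinate \<open>i\<close> flips the parity, so the next
        parent is traversed in the opposite direction: its first digit equals the last digit of the
        old one.\<close>
      have 1: "even (\<Sum>j\<in>- {c m}. q' j) \<longleftrightarrow> odd (\<Sum>j\<in>- {c m}. q j)"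
        using False unfolding i
        by (subst (1 2) split_sum[of "c m" i]) auto
      \<comment> \<open>The digit \<open>g\<close> is 0 or 2 here, so \<open>3 * q (c m) + g\<close>
        has the parity of \<open>q (c m)\<close> and the sign of the step in \<open>i\<close>
        persists.\<close>
      have 2: "even (\<Sum>j\<in>- {i}. (q(c m := 3 * q (c m) + g)) j) \<longleftrightarrow> even (\<Sum>j\<in>- {i}. q j)"
        if "even g" for g
        using False that by (subst (1 2) split_sum[of i "c m"]) auto
      show ?thesis
        using i False mod \<open>k mod 3 = 2\<close> 1 2
        by (intro exI[of _ i]) (auto simp: Let_def fun_eq_iff simp flip: q_def q'_def)
    qed
  qed
qed

lemma peano_Suc_index_close:
  assumes "Suc k < 3 ^ m"
  shows "\<bar>peano c m (Suc k) i - peano c m k i\<bar> \<le> 1"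
  using peano_Suc_index[OF assms, of c] by auto

lemma peano_bounds: "0 \<le> peano c m k i \<and> peano c m k i < 3 ^ depth c m i"
proof (induction m arbitrary: k)
  case (Suc m)
  define g where "g = (if even (\<Sum>j\<in>- {c m}. peano c m (k div 3) j)
    then int (k mod 3) else 2 - int (k mod 3))"
  have "0 \<le> g \<and> g \<le> 2"
    by (auto simp: g_def)
  then show ?case
    using Suc[of "k div 3"] by (auto simp: Let_def simp flip: g_def)
qed simp

text \<open>Decoding starts at the last digit: dividing coordinate \<open>c m\<close> by 3 recovers
  the parent, whose other coordinates decide whether the remainder was reflected.\<close>

lemma inj_on_peano: "inj_on (peano c m) {..<3 ^ m}"
proof (induction m)
  case 0
  then show ?case by (auto simp: inj_on_def)
next
  case (Suc m)
  show ?case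
  proof (rule inj_onI)
    fix k l assume kl: "k \<in> {..<3 ^ Suc m}" "l \<in> {..<3 ^ Suc m}"
      and eq: "peano c (Suc m) k = peano c (Suc m) l"
    define g where "g n = (if even (\<Sum>j\<in>- {c m}. peano c m (n div 3) j)
      then int (n mod 3) else 2 - int (n mod 3))" for n
    have g: "0 \<le> g n \<and> g n \<le> 2" for n
      by (auto simp: g_def)
    have P: "peano c (Suc m) n =
        (peano c m (n div 3))(c m := 3 * peano c m (n div 3) (c m) + g n)" for n
      by (simp add: g_def Let_def)
    have "3 * peano c m (k div 3) (c m) + g k = 3 * peano c m (l div 3) (c m) + g l"
      using fun_cong[OF eq, of "c m"] unfolding P by simp
    then have c: "peano c m (k div 3) (c m) = peano c m (l div 3) (c m)" and "g k = g l"
      using g[of k] g[of l] by presburger+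
    have q: "peano c m (k div 3) = peano c m (l div 3)"
    proof
      fix i show "peano c m (k div 3) i = peano c m (l div 3) i"
        using fun_cong[OF eq, of i] c unfolding P by (cases "i = c m") auto
    qed
    have "k div 3 = l div 3"
      using inj_onD[OF Suc q] kl by auto
    moreover have "k mod 3 = l mod 3"
      using \<open>g k = g l\<close> q by (auto simp: g_def split: if_splits)
    ultimately show "k = l"
      by (metis div_mult_mod_eq)
  qed
qed

lemma sum_depth: "(\<Sum>i\<in>UNIV. depth c m (i :: 'd :: finite)) = m"
  by (induction m) (auto simp: sum.distrib)

text \<open>An injection between sets of equal size: the box has \<open>3 ^ m\<close> points because
  the depths add up to \<open>m\<close>.\<close>

lemma bij_betw_peano:
  "bij_betw (peano c m) {..<3 ^ m} (PiE UNIV (\<lambda>i. {0..<3 ^ depth c m i}))"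
  unfolding bij_betw_def
proof (intro conjI inj_on_peano card_subset_eq)
  show "card (peano c m ` {..<3 ^ m}) = card (PiE UNIV (\<lambda>i. {0..<3 ^ depth c m i :: int}))"
    by (simp add: card_image inj_on_peano card_PiE sum_depth nat_power_eq flip: power_sum)
qed (use peano_bounds[of c m] in \<open>auto intro!: finite_PiE\<close>)

section \<open>Dealing the digits to the coordinates in rotation\<close>

text \<open>Rotation keeps the boxes balanced: after \<open>CARD('d) * n\<close> digits they are
  cubes of side \<open>1 / 3 ^ n\<close>, which is what yields the exponent
  \<open>1 / CARD('d)\<close>.\<close>

definition cyclic :: "nat \<Rightarrow> 'd::finite" where
  "cyclic l = inv_into UNIV (to_nat_on UNIV) (l mod CARD('d))"

lemma depth_cyclic:
  "depth cyclic m (i :: 'd::finite) =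
    m div CARD('d) + (if to_nat_on (UNIV :: 'd set) i < m mod CARD('d) then 1 else 0)"
proof (induction m)
  case (Suc m)
  let ?r = "to_nat_on (UNIV :: 'd set)"
  have inj: "inj ?r" and r: "range ?r = {..<CARD('d)}"
    using to_nat_on_finite[of "UNIV :: 'd set"] by (auto simp: bij_betw_def)
  have "cyclic m = i \<longleftrightarrow> m mod CARD('d) = ?r i"
    unfolding cyclic_def using r inj
    by (metis f_inv_into_f inv_f_f lessThan_iff mod_less_divisor zero_less_card_finite)
  moreover have "?r i < CARD('d)"
    using r by auto
  ultimately show ?case
    using Suc by (auto simp: mod_Suc div_Suc)
qed simp

lemma depth_cyclic_mult: "depth cyclic (CARD('d) * n) (i :: 'd::finite) = n"
  by (simp add: depth_cyclic)

lemma filterlim_depth_cyclic: "filterlim (\<lambda>m. depth cyclic m (i :: 'd::finite)) at_top sequentially"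
  unfolding filterlim_at_top
proof
  fix n
  have "n \<le> depth cyclic m i" if "CARD('d) * n \<le> m" for m
    using div_le_mono[OF that, of "CARD('d)"] by (simp add: depth_cyclic)
  then show "\<forall>\<^sub>F m in sequentially. n \<le> depth cyclic m i"
    unfolding eventually_sequentially by blast
qed

section \<open>The Peano curve\<close>

text \<open>The cells are \<open>(k / 3 ^ m, (k + 1) / 3 ^ m]\<close>, so that \<open>1\<close> lies in the last one; truncated
  subtraction puts \<open>0\<close> into the first one.\<close>

definition cell :: "nat \<Rightarrow> real \<Rightarrow> nat" where
  "cell m t = nat \<lceil>3 ^ m * t\<rceil> - 1"

text \<open>Matches the recursion of \<open>peano\<close>: the ceiling of \<open>3 * x\<close> is
  one of the three integers ending at three times the ceiling of \<open>x\<close>. For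
  \<open>t \<le> 0\<close> both sides are 0.\<close>

lemma cell_Suc_div: "cell (Suc m) t div 3 = cell m t"
proof -
  have "\<lceil>3 * x\<rceil> \<le> 3 * \<lceil>x\<rceil> \<and> 3 * \<lceil>x\<rceil> - 3 < \<lceil>3 * x\<rceil>" for x :: real
    by linarith
  from this[of "3 ^ m * t"] show ?thesis
    unfolding cell_def by (simp add: mult.assoc) linarith
qed

lemma cell_less:
  assumes "t \<le> 1"
  shows "cell m t < 3 ^ m"
proof -
  have "3 ^ m * t \<le> 3 ^ m" using assms by simp
  then have "\<lceil>3 ^ m * t\<rceil> \<le> 3 ^ m"
    by (simp add: ceiling_le_iff)
  then have "nat \<lceil>3 ^ m * t\<rceil> \<le> 3 ^ m"
    by (simp add: nat_le_iff)
  then show ?thesis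
    unfolding cell_def by (metis Suc_diff_1 Suc_le_eq diff_is_0_eq' diff_le_self le_neq_implies_less less_le_trans nat_le_linear not_gr_zero zero_less_numeral zero_less_power)
qed

lemma cell_bounds:
  assumes "0 \<le> t"
  shows "real (cell m t) \<le> 3 ^ m * t \<and> 3 ^ m * t \<le> real (cell m t) + 1"
proof -
  have "0 \<le> 3 ^ m * t" using assms by simp
  then show ?thesis unfolding cell_def by linarith
qed

lemma cell_eq:
  assumes "real k < 3 ^ m * t" "3 ^ m * t \<le> real k + 1"
  shows "cell m t = k"
  using assms unfolding cell_def by linarith

lemma cell_adjacent:
  assumes "0 \<le> s" "s \<le> t" "t - s \<le> 1 / 3 ^ m"
  shows "cell m t = cell m s \<or> cell m t = Suc (cell m s)"
proof -
  have "3 ^ m * t - 3 ^ m * s \<le> 1"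
    using assms(3) by (simp add: field_simps)
  moreover have "0 \<le> 3 ^ m * s" "3 ^ m * s \<le> 3 ^ m * t"
    using assms by auto
  ultimately show ?thesis unfolding cell_def by linarith
qed

text \<open>The lowest corner of the \<open>k\<close>-th box, not the point where the curve enters
  it.\<close>

definition peano_point :: "(nat \<Rightarrow> 'd) \<Rightarrow> nat \<Rightarrow> nat \<Rightarrow> real ^ 'd::finite" where
  "peano_point c m k = (\<chi> i. real_of_int (peano c m k i) / 3 ^ depth c m i)"

text \<open>The box of a cell lies in the box of its parent, since the new digit is at least 0 and
  at most 2.\<close>

lemma peano_point_nested:
  "peano_point c m (k div 3) $ i \<le> peano_point c (Suc m) k $ i"
  "peano_point c (Suc m) k $ i + 1 / 3 ^ depth c (Suc m) i
    \<le> peano_point c m (k div 3) $ i + 1 / 3 ^ depth c m i"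
proof -
  define g where "g = (if even (\<Sum>j\<in>- {c m}. peano c m (k div 3) j)
    then int (k mod 3) else 2 - int (k mod 3))"
  have "0 \<le> g \<and> g \<le> 2"
    by (auto simp: g_def)
  then show "peano_point c m (k div 3) $ i \<le> peano_point c (Suc m) k $ i"
    "peano_point c (Suc m) k $ i + 1 / 3 ^ depth c (Suc m) i
      \<le> peano_point c m (k div 3) $ i + 1 / 3 ^ depth c m i"
    by (auto simp: peano_point_def Let_def field_simps simp flip: g_def)
qed

definition peano_curve :: "(nat \<Rightarrow> 'd) \<Rightarrow> real \<Rightarrow> real ^ 'd::finite" where
  "peano_curve c t = (\<chi> i. lim (\<lambda>m. peano_point c m (cell m t) $ i))"

text \<open>In each coordinate the boxes give nested intervals. Their lengths tend to 0 because
  every coordinate receives infinitely many digits, and the curve is their common point.\<close>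

lemma
  assumes "\<And>i. filterlim (\<lambda>m. depth c m i) at_top sequentially"
  shows peano_curve_bounds: "peano_point c m (cell m t) $ i \<le> peano_curve c t $ i"
      "peano_curve c t $ i \<le> peano_point c m (cell m t) $ i + 1 / 3 ^ depth c m i"
    and peano_point_tendsto: "(\<lambda>m. peano_point c m (cell m t)) \<longlonglongrightarrow> peano_curve c t"
proof -
  define a where "a m i = peano_point c m (cell m t) $ i" for m i
  have step: "a m i \<le> a (Suc m) i"
    "a (Suc m) i + 1 / 3 ^ depth c (Suc m) i \<le> a m i + 1 / 3 ^ depth c m i" for m i
    using peano_point_nested[of c m "cell (Suc m) t" i] by (simp_all add: a_def cell_Suc_div)
  have "(\<lambda>m. 1 / 3 ^ depth c m i :: real) \<longlonglongrightarrow> 0" for i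
  proof -
    have "(\<lambda>n. 1 / 3 ^ n :: real) \<longlonglongrightarrow> 0"
      using LIMSEQ_realpow_zero[of "1 / 3"] by (simp add: power_one_over)
    from filterlim_compose[OF this assms] show ?thesis .
  qed
  then have small: "(\<lambda>m. a m i - (a m i + 1 / 3 ^ depth c m i)) \<longlonglongrightarrow> 0" for i
    using tendsto_minus by fastforce
  have ex: "\<exists>l. ((\<forall>m. a m i \<le> l) \<and> (\<lambda>m. a m i) \<longlonglongrightarrow> l) \<and>
      ((\<forall>m. l \<le> a m i + 1 / 3 ^ depth c m i) \<and> (\<lambda>m. a m i + 1 / 3 ^ depth c m i) \<longlonglongrightarrow> l)" for i
    by (rule nested_sequence_unique) (use step small in auto)
  have *: "a m i \<le> peano_curve c t $ i \<and> peano_curve c t $ i \<le> a m i + 1 / 3 ^ depth c m i \<and>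
      (\<lambda>m. a m i) \<longlonglongrightarrow> peano_curve c t $ i" for m i
    using ex[of i] by (auto simp: peano_curve_def limI simp flip: a_def)
  then show "peano_point c m (cell m t) $ i \<le> peano_curve c t $ i"
    "peano_curve c t $ i \<le> peano_point c m (cell m t) $ i + 1 / 3 ^ depth c m i"
    by (simp_all add: a_def)
  show "(\<lambda>m. peano_point c m (cell m t)) \<longlonglongrightarrow> peano_curve c t"
    by (rule vec_tendstoI) (use * in \<open>simp add: a_def\<close>)
qed

section \<open>Equality of distributions\<close>

text \<open>Continuous cut-offs for a closed set. Off \<open>C\<close> the distance is positive, so
  the terms are eventually 0.\<close>

lemma tendsto_infdist_indicator:
  fixes C :: "'a::metric_space set"
  assumes "closed C" "C \<noteq> {}"
  shows "(\<lambda>k. max 0 (1 - real k * infdist x C)) \<longlonglongrightarrow> indicator C x"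
proof (cases "x \<in> C")
  case False
  then have pos: "infdist x C > 0"
    using assms by (simp add: infdist_pos_not_in_closed)
  have "\<forall>\<^sub>F k in sequentially. real k \<ge> 1 / infdist x C"
    using filterlim_real_sequentially by (simp add: filterlim_at_top)
  then have "\<forall>\<^sub>F k in sequentially. max 0 (1 - real k * infdist x C) = 0"
    by eventually_elim (use pos in \<open>simp add: field_simps\<close>)
  then show ?thesis
    using False by (simp add: tendsto_eventually)
qed simp

text \<open>By dominated convergence the integrals determine the measure of every closed set, and
  the closed sets are an intersection-stable generator of the Borel sets.\<close>

lemma finite_measure_eqI_continuous:
  fixes M N :: "'a::metric_space measure"
  assumes "finite_measure M" "finite_measure N"
    and sets [simp, measurable_cong]: "sets M = sets borel" "sets N = sets borel"
    and eq: "\<And>f :: 'a \<Rightarrow> real. continuous_on UNIV f \<Longrightarrow> (\<And>x. 0 \<le> f x \<and> f x \<le> 1) \<Longrightarrow>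
      (\<integral>x. f x \<partial>M) = (\<integral>x. f x \<partial>N)"
  shows "M = N"
proof -
  interpret M: finite_measure M by fact
  interpret N: finite_measure N by fact
  have "emeasure M C = emeasure N C" if C: "closed C" for C
  proof (cases "C = {}")
    case False
    define f where "f k x = max 0 (1 - real k * infdist x C)" for k x
    have [measurable]: "C \<in> sets borel"
      using C by simp
    have cont: "continuous_on UNIV (f k)" for k
      unfolding f_def by (intro continuous_intros)
    then have [measurable]: "f k \<in> borel_measurable borel" for k
      by (rule borel_measurable_continuous_onI)
    have bnd: "0 \<le> f k x \<and> f k x \<le> 1" for k x
      by (auto simp: f_def infdist_nonneg)
    have limf: "(\<lambda>k. f k x) \<longlonglongrightarrow> indicator C x" for x
      unfolding f_def by (rule tendsto_infdist_indicator[OF C False])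
    have lim: "(\<lambda>k. \<integral>x. f k x \<partial>L) \<longlonglongrightarrow> measure L C"
      if "finite_measure L" and [measurable_cong]: "sets L = sets borel" for L
    proof -
      interpret finite_measure L by fact
      have "(\<lambda>k. \<integral>x. f k x \<partial>L) \<longlonglongrightarrow> (\<integral>x. indicator C x \<partial>L)"
        by (rule integral_dominated_convergence[where w = "\<lambda>_. 1"])
          (use bnd limf in auto)
      then show ?thesis
        using sets_eq_imp_space_eq[OF that(2)] by simp
    qed
    have "measure M C = measure N C"
      using lim[OF assms(1,3)] lim[OF assms(2,4)] eq[OF cont bnd]
      by (simp add: LIMSEQ_unique)
    then show ?thesis
      by (simp add: M.emeasure_eq_measure N.emeasure_eq_measure)
  qed simp
  then show ?thesis
    by (intro measure_eqI_generator_eq[where E = "Collect closed" and \<Omega> = UNIV and A = "\<lambda>_. UNIV"])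
      (auto simp: Int_stable_def borel_eq_closed)
qed

text \<open>Integrals of bounded continuous functions pass to the limit on both sides, and these
  determine a law.\<close>

lemma distr_eq_of_tendsto:
  fixes F :: "nat \<Rightarrow> 'a \<Rightarrow> 'c::metric_space" and G :: "nat \<Rightarrow> 'b \<Rightarrow> 'c"
  assumes "prob_space M" "prob_space N"
    and [measurable]: "\<And>n. F n \<in> borel_measurable M" "\<And>n. G n \<in> borel_measurable N"
    and eq: "\<And>n. distr M borel (F n) = distr N borel (G n)"
    and F: "\<And>x. x \<in> space M \<Longrightarrow> (\<lambda>n. F n x) \<longlonglongrightarrow> f x"
    and G: "\<And>x. x \<in> space N \<Longrightarrow> (\<lambda>n. G n x) \<longlonglongrightarrow> g x"
  shows "distr M borel f = distr N borel g"
proof -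
  interpret M: prob_space M by fact
  interpret N: prob_space N by fact
  have [measurable]: "f \<in> borel_measurable M" "g \<in> borel_measurable N"
    by (rule borel_measurable_LIMSEQ_metric[OF _ F] borel_measurable_LIMSEQ_metric[OF _ G]; simp)+
  show ?thesis
  proof (rule finite_measure_eqI_continuous)
    fix h :: "'c \<Rightarrow> real"
    assume cont: "continuous_on UNIV h" and bnd: "\<And>x. 0 \<le> h x \<and> h x \<le> 1"
    then have [measurable]: "h \<in> borel_measurable borel"
      by (simp add: borel_measurable_continuous_onI)
    have tendsto_h: "(\<lambda>n. h (u n)) \<longlonglongrightarrow> h y" if "u \<longlonglongrightarrow> y" for u y
      using continuous_on_tendsto_compose[OF cont that] by simp
    have "(\<lambda>n. \<integral>x. h (F n x) \<partial>M) \<longlonglongrightarrow> (\<integral>x. h (f x) \<partial>M)"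
      by (rule integral_dominated_convergence[where w = "\<lambda>_. 1"])
        (use bnd F tendsto_h in auto)
    moreover have "(\<lambda>n. \<integral>x. h (G n x) \<partial>N) \<longlonglongrightarrow> (\<integral>x. h (g x) \<partial>N)"
      by (rule integral_dominated_convergence[where w = "\<lambda>_. 1"])
        (use bnd G tendsto_h in auto)
    moreover have "(\<integral>x. h (F n x) \<partial>M) = (\<integral>x. h (G n x) \<partial>N)" for n
      using arg_cong[OF eq[of n], of "\<lambda>L. \<integral>x. h x \<partial>L"] by (simp add: integral_distr)
    ultimately show "(\<integral>x. h x \<partial>distr M borel f) = (\<integral>x. h x \<partial>distr N borel g)"
      by (simp add: integral_distr LIMSEQ_unique)
  qed (auto intro: M.finite_measure_distr N.finite_measure_distr)
qed

text \<open>A law on a finite set is the sum of its point masses; points are closed in a T1 space,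
  so the fibres are measurable.\<close>

lemma distr_eqI_finite_range:
  fixes f :: "'a \<Rightarrow> 'c::t1_space"
  assumes [measurable]: "f \<in> borel_measurable M" "g \<in> borel_measurable N"
    and "finite S"
    and S: "\<And>x. x \<in> space M \<Longrightarrow> f x \<in> S" "\<And>x. x \<in> space N \<Longrightarrow> g x \<in> S"
    and eq: "\<And>s. s \<in> S \<Longrightarrow>
      emeasure M {x \<in> space M. f x = s} = emeasure N {x \<in> space N. g x = s}"
  shows "distr M borel f = distr N borel g"
proof (rule measure_eqI)
  fix A assume "A \<in> sets (distr M borel f)"
  then have A[measurable]: "A \<in> sets borel" by simp
  have fib: "emeasure L (h -` A \<inter> space L) = (\<Sum>s\<in>S \<inter> A. emeasure L {x \<in> space L. h x = s})"
    if [measurable]: "h \<in> borel_measurable L" and "\<And>x. x \<in> space L \<Longrightarrow> h x \<in> S"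
    for L :: "'d measure" and h
  proof -
    have "{x \<in> space L. h x = s} \<in> sets L" for s
      using measurable_sets[OF that(1), of "{s}"] by (simp add: vimage_def Int_def conj_commute)
    then have "(\<Sum>s\<in>S \<inter> A. emeasure L {x \<in> space L. h x = s}) =
        emeasure L (\<Union>s\<in>S \<inter> A. {x \<in> space L. h x = s})"
      using \<open>finite S\<close> by (intro sum_emeasure) (auto simp: disjoint_family_on_def)
    moreover have "h -` A \<inter> space L = (\<Union>s\<in>S \<inter> A. {x \<in> space L. h x = s})"
      using that(2) by auto
    ultimately show ?thesis
      by simp
  qed
  show "emeasure (distr M borel f) A = emeasure (distr N borel g) A"
    using fib[of f M] fib[of g N] S eq by (simp add: emeasure_distr)
qed simp

text \<open>The boundary of a box is null, so it does not matter which faces belong to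
  \<open>A\<close>. This covers the half-open cells and the extra point 0 of the first one.\<close>

lemma emeasure_lborel_between_box:
  fixes l u :: "'a::euclidean_space"
  assumes "box l u \<subseteq> A" "A \<subseteq> cbox l u" "A \<in> sets lborel"
    and e: "\<And>b. b \<in> Basis \<Longrightarrow> (u - l) \<bullet> b = e" "0 \<le> e"
  shows "emeasure lborel A = ennreal (e ^ DIM('a))"
proof -
  have le: "l \<bullet> b \<le> u \<bullet> b" if "b \<in> Basis" for b
    using e(1)[OF that] e(2) by (simp add: inner_diff_left)
  have "emeasure lborel (box l u) \<le> emeasure lborel A"
    "emeasure lborel A \<le> emeasure lborel (cbox l u)"
    using assms by (auto intro: emeasure_mono)
  moreover have "emeasure lborel (box l u) = ennreal (e ^ DIM('a))"
    "emeasure lborel (cbox l u) = ennreal (e ^ DIM('a))"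
    using le e(1) by (simp_all add: emeasure_lborel_box emeasure_lborel_cbox)
  ultimately show ?thesis
    by simp
qed

section \<open>Uniform distribution of the approximations on the grid\<close>

lemma measurable_cell [measurable]: "cell m \<in> measurable borel (count_space UNIV)"
  unfolding cell_def by measurable

lemma emeasure_unit_interval_cell:
  assumes "k < 3 ^ m"
  shows "emeasure unit_interval {t \<in> space unit_interval. cell m t = k} = ennreal (1 / 3 ^ m)"
proof -
  let ?l = "real k / 3 ^ m" and ?u = "(real k + 1) / 3 ^ m"
  let ?A = "{t \<in> {0..1}. cell m t = k}"
  have "real k + 1 \<le> 3 ^ m"
    using assms by (metis Suc_leI add.commute of_nat_Suc of_nat_le_iff of_nat_numeral of_nat_power)
  then have l: "0 \<le> ?l" and u: "?u \<le> 1"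
    by auto
  have "t \<in> {0..1} \<and> cell m t = k" if t: "?l < t" "t < ?u" for t
  proof -
    have "cell m t = k"
      using t by (intro cell_eq) (simp_all add: field_simps)
    moreover have "0 \<le> t" "t \<le> 1"
      using t l u by linarith+
    ultimately show ?thesis by simp
  qed
  then have box: "box ?l ?u \<subseteq> ?A"
    by (auto simp: box_real)
  have cbox: "?A \<subseteq> cbox ?l ?u"
    using cell_bounds[of _ m] by (auto simp: cbox_interval field_simps)
  have "emeasure unit_interval ?A = emeasure lborel ?A"
    unfolding unit_interval_def by (rule emeasure_restrict_space) auto
  also have "\<dots> = ennreal ((1 / 3 ^ m) ^ DIM(real))"
    by (rule emeasure_lborel_between_box[OF box cbox]) (auto simp: field_simps)
  finally show ?thesis
    by (simp add: space_unit_interval)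
qed

lemma measurable_vec_nth_borel [measurable]: "(\<lambda>x :: real ^ 'd. x $ i) \<in> borel_measurable borel"
  by (intro borel_measurable_continuous_onI continuous_intros)

lemma emeasure_unit_cube_cell:
  fixes k :: "'d::finite \<Rightarrow> nat"
  assumes "\<And>i. k i < 3 ^ n"
  shows "emeasure unit_cube {x \<in> space unit_cube. \<forall>i. cell n (x $ i) = k i} =
    ennreal (1 / 3 ^ (CARD('d) * n))"
proof -
  let ?l = "(\<chi> i. real (k i) / 3 ^ n) :: real ^ 'd"
  let ?u = "(\<chi> i. (real (k i) + 1) / 3 ^ n) :: real ^ 'd"
  let ?A = "{x :: real ^ 'd. (\<forall>i. x $ i \<in> {0..1}) \<and> (\<forall>i. cell n (x $ i) = k i)}"
  have "real (k i) + 1 \<le> 3 ^ n" for i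
    using assms[of i] by (metis Suc_leI add.commute of_nat_Suc of_nat_le_iff of_nat_numeral of_nat_power)
  then have lu: "0 \<le> ?l $ i" "?u $ i \<le> 1" for i
    by auto
  have in01: "x $ i \<in> {0..1} \<and> cell n (x $ i) = k i" if "x \<in> box ?l ?u" for x i
  proof -
    have x: "?l $ i < x $ i" "x $ i < ?u $ i"
      using that by (auto simp: mem_box_cart)
    then have "cell n (x $ i) = k i"
      by (intro cell_eq) (simp_all add: field_simps)
    moreover have "0 \<le> x $ i" "x $ i \<le> 1"
      using x lu[of i] by linarith+
    ultimately show ?thesis by simp
  qed
  then have box: "box ?l ?u \<subseteq> ?A"
    by blast
  have cbox: "?A \<subseteq> cbox ?l ?u"
    using cell_bounds[of _ n] by (fastforce simp: mem_box_cart field_simps)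
  have [measurable]: "?A \<in> sets lborel"
    by measurable
  have cube: "{x :: real ^ 'd. \<forall>i. x $ i \<in> {0..1}} \<in> sets lborel"
    by measurable
  have "emeasure unit_cube ?A = emeasure lborel ?A"
    unfolding unit_cube_def by (rule emeasure_restrict_space) (use cube in auto)
  also have "\<dots> = ennreal ((1 / 3 ^ n) ^ DIM(real ^ 'd))"
    by (rule emeasure_lborel_between_box[OF box cbox])
      (auto simp: Basis_vec_def inner_axis field_simps)
  finally show ?thesis
    by (simp add: space_unit_cube power_one_over power_mult[symmetric] mult.commute)
qed

text \<open>Rounding down to the grid, where positive multiples of the mesh move one step down
  because the cells are closed on the right.\<close>

definition grid_point :: "nat \<Rightarrow> real ^ 'd \<Rightarrow> real ^ 'd::finite" where
  "grid_point n x = (\<chi> i. real (cell n (x $ i)) / 3 ^ n)"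

lemma grid_point_tendsto:
  assumes "x \<in> space unit_cube"
  shows "(\<lambda>n. grid_point n x) \<longlonglongrightarrow> x"
proof (rule vec_tendstoI)
  fix i
  have x: "0 \<le> x $ i"
    using assms by (auto simp: space_unit_cube)
  have lim0: "(\<lambda>n. 1 / 3 ^ n :: real) \<longlonglongrightarrow> 0"
    using LIMSEQ_realpow_zero[of "1 / 3"] by (simp add: power_one_over)
  have "dist (grid_point n x $ i) (x $ i) \<le> 1 / 3 ^ n" for n
  proof -
    have "real (cell n (x $ i)) / 3 ^ n \<le> x $ i"
      "x $ i \<le> real (cell n (x $ i)) / 3 ^ n + 1 / 3 ^ n"
      using cell_bounds[OF x, of n] by (simp_all add: field_simps)
    then show ?thesis
      by (simp add: grid_point_def dist_real_def)
  qed
  then show "(\<lambda>n. grid_point n x $ i) \<longlonglongrightarrow> x $ i"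
    unfolding tendsto_dist_iff[of _ "x $ i"]
    by (intro tendsto_sandwich[OF _ _ tendsto_const lim0]) auto
qed

lemma measurable_grid_point: "grid_point n \<in> borel_measurable borel"
  unfolding grid_point_def
  by (subst borel_measurable_euclidean_space) (auto simp: Basis_vec_def inner_axis)

text \<open>Both laws are uniform on a grid of \<open>3 ^ m\<close> points: \<open>peano\<close>
  matches each grid point with one interval of length \<open>1 / 3 ^ m\<close>, and rounding matches
  it with a cube of the same volume.\<close>

lemma distr_peano_point:
  fixes n :: nat
  defines "m \<equiv> CARD('d) * n"
  shows "distr unit_interval borel (\<lambda>t. peano_point cyclic m (cell m t)) =
    distr unit_cube borel (grid_point n :: real ^ 'd::finite \<Rightarrow> real ^ 'd)"
proof (rule distr_eqI_finite_range)
  define J where "J = PiE (UNIV :: 'd set) (\<lambda>_. {0..<3 ^ n :: int})"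
  define vec where "vec j = ((\<chi> i. real_of_int (j i) / 3 ^ n) :: real ^ 'd)" for j
  have vec_inj: "vec j = vec j' \<longleftrightarrow> j = j'" for j j'
    by (auto simp: vec_def vec_eq_iff fun_eq_iff)
  have bij: "bij_betw (peano (cyclic :: nat \<Rightarrow> 'd) m) {..<3 ^ m} J"
    using bij_betw_peano[of "cyclic :: nat \<Rightarrow> 'd" m] by (simp add: m_def depth_cyclic_mult J_def)
  have point: "peano_point cyclic m k = vec (peano cyclic m k)" for k
    by (simp add: peano_point_def vec_def m_def depth_cyclic_mult)
  have grid: "grid_point n x = vec (\<lambda>i. int (cell n (x $ i)))" for x
    by (simp add: grid_point_def vec_def)
  show "(\<lambda>t. peano_point cyclic m (cell m t) :: real ^ 'd) \<in> borel_measurable unit_interval"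
    unfolding unit_interval_def by (rule measurable_restrict_space1) measurable
  show "grid_point n \<in> borel_measurable (unit_cube :: (real ^ 'd) measure)"
    unfolding unit_cube_def
    by (rule measurable_restrict_space1) (simp add: measurable_grid_point)
  show "finite (vec ` J)"
    by (simp add: J_def finite_PiE)
  show "peano_point cyclic m (cell m t) \<in> vec ` J" if "t \<in> space unit_interval" for t
    using that bij cell_less[of t m] unfolding point
    by (auto simp: space_unit_interval dest: bij_betwE)
  have "int (cell n (x $ i)) < 3 ^ n" if "x \<in> space unit_cube" for x :: "real ^ 'd" and i
    using that cell_less[of "x $ i" n] by (auto simp: space_unit_cube nat_less_iff zless_nat_eq_int_zless)
  then show "grid_point n x \<in> vec ` J" if "x \<in> space unit_cube" for x
    using that unfolding grid by (auto simp: J_def)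
  fix s assume "s \<in> vec ` J"
  then obtain j where j: "j \<in> J" "s = vec j"
    by blast
  then obtain k where k: "k < 3 ^ m" "peano cyclic m k = j"
    using bij by (auto simp: bij_betw_def)
  \<comment> \<open>Injectivity of \<open>peano\<close> reduces the fibre over \<open>j\<close> to
    the single cell \<open>k\<close>.\<close>
  have "cell m t = k \<longleftrightarrow> peano (cyclic :: nat \<Rightarrow> 'd) m (cell m t) = j" if "t \<in> space unit_interval" for t
    using that k bij cell_less[of t m]
    by (auto simp: bij_betw_def space_unit_interval dest!: inj_onD)
  then have "{t \<in> space unit_interval. peano_point cyclic m (cell m t) = s} =
      {t \<in> space unit_interval. cell m t = k}"
    by (auto simp: point j vec_inj)
  moreover have "{x \<in> space unit_cube. grid_point n x = s} =
      {x \<in> space unit_cube. \<forall>i. cell n (x $ i) = nat (j i)}"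
  proof -
    have "0 \<le> j i" for i
      using j(1) by (auto simp: J_def PiE_def Pi_def)
    then have "int c = j i \<longleftrightarrow> c = nat (j i)" for c i
      by (metis int_nat_eq nat_int)
    then show ?thesis
      by (auto simp: grid j vec_inj fun_eq_iff eq_nat_nat_iff)
  qed
  moreover have "nat (j i) < 3 ^ n" for i
    using j(1) by (auto simp: J_def PiE_def Pi_def nat_less_iff)
  ultimately show "emeasure unit_interval {t \<in> space unit_interval. peano_point cyclic m (cell m t) = s} =
      emeasure unit_cube {x \<in> space unit_cube. grid_point n x = s}"
    using k(1) by (simp add: emeasure_unit_interval_cell emeasure_unit_cube_cell m_def)
qed


text \<open>The box at level 0 is the whole unit cube, whatever the value of
  \<open>t\<close>.\<close>

lemma peano_curve_cyclic_in_cube: "peano_curve cyclic t \<in> space unit_cube"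
proof -
  have "0 \<le> peano_curve cyclic t $ i \<and> peano_curve cyclic t $ i \<le> 1" for i :: 'a
    using peano_curve_bounds[OF filterlim_depth_cyclic, where m = 0 and t = t and i = i] by (simp add: peano_point_def)
  then show ?thesis
    by (simp add: space_unit_cube)
qed

section \<open>Hoelder continuity and measure preservation\<close>

lemma peano_point_adjacent:
  assumes "0 \<le> s" "s \<le> t" "t \<le> 1" "t - s \<le> 1 / 3 ^ m"
  shows "\<bar>peano_point c m (cell m t) $ i - peano_point c m (cell m s) $ i\<bar> \<le> 1 / 3 ^ depth c m i"
proof -
  have "\<bar>peano c m (cell m t) i - peano c m (cell m s) i\<bar> \<le> 1"
    using cell_adjacent[OF assms(1,2,4)] cell_less[OF assms(3), of m]
      peano_Suc_index_close[of "cell m s" m c i]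
    by auto
  then have "\<bar>real_of_int (peano c m (cell m t) i) - real_of_int (peano c m (cell m s) i)\<bar> \<le> 1"
    by linarith
  then show ?thesis
    by (simp add: peano_point_def divide_right_mono abs_divide flip: diff_divide_distrib)
qed

lemma peano_curve_holder_aux:
  assumes "0 \<le> s" "s < t" "t \<le> 1"
  shows "dist (peano_curve cyclic s) (peano_curve cyclic t :: real ^ 'd::finite)
    \<le> 6 * CARD('d) * (t - s) powr (1 / CARD('d))"
proof -
  define d where "d = CARD('d)"
  have d: "d > 0" by (simp add: d_def)
  \<comment> \<open>After \<open>d * n\<close> digits the parameter intervals have length
    \<open>q ^ n\<close> and the image cubes have side \<open>1 / 3 ^ n\<close>, the
    \<open>d\<close>-th root of that length.\<close>
  define q :: real where "q = 1 / 3 ^ d"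
  have "(1::real) < 3 ^ d"
    using d by (simp add: one_less_power)
  then have "q < 1" "0 < t - s"
    using assms by (auto simp: q_def)
  then have ex: "\<exists>n. q ^ n < t - s"
    by (metis real_arch_pow_inv)
  \<comment> \<open>The first scale finer than the distance. It bounds \<open>1 / 3 ^ n\<close> by
    the desired power, while at the previous scale \<open>p\<close> both parameters lie in equal or
    neighbouring cells.\<close>
  define n where "n = (LEAST n. q ^ n < t - s)"
  have n: "q ^ n < t - s"
    unfolding n_def by (rule LeastI_ex[OF ex])
  have "n \<noteq> 0"
    using n assms by (intro notI) simp
  then obtain p where p: "n = Suc p"
    by (cases n) auto
  have "t - s \<le> q ^ p"
    using not_less_Least[of p "\<lambda>n. q ^ n < t - s"] p by (simp add: n_def not_less)
  then have close: "t - s \<le> 1 / 3 ^ (d * p)"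
    by (simp add: q_def power_one_over power_mult)
  have "(1 / 3 ^ n) ^ d < t - s"
    using n by (simp add: q_def power_one_over mult.commute flip: power_mult)
  then have "((1 / 3 ^ n) ^ d) powr (1 / d) \<le> (t - s) powr (1 / d)"
    by (intro powr_mono2) auto
  moreover have "((1 / 3 ^ n :: real) ^ d) powr (1 / d) = 1 / 3 ^ n"
    using d by (simp add: powr_powr flip: powr_realpow)
  ultimately have scale: "1 / 3 ^ n \<le> (t - s) powr (1 / d)"
    by simp
  have coord: "\<bar>(peano_curve cyclic s - peano_curve cyclic t) $ i\<bar> \<le> 6 * (t - s) powr (1 / d)" for i :: 'd
  proof -
    let ?P = "\<lambda>u. peano_point cyclic (d * p) (cell (d * p) u) $ i"
    have depth: "depth cyclic (d * p) i = p"
      by (simp add: d_def depth_cyclic_mult)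
    have adj: "\<bar>?P t - ?P s\<bar> \<le> 1 / 3 ^ p"
      using peano_point_adjacent[of s t "d * p" cyclic i] assms close by (simp add: depth)
    have "?P u \<le> peano_curve cyclic u $ i" "peano_curve cyclic u $ i \<le> ?P u + 1 / 3 ^ p" for u
      using peano_curve_bounds[OF filterlim_depth_cyclic, where m = "d * p" and t = u and i = i]
      by (simp_all add: depth)
    \<comment> \<open>One side for the distance of the corners and one for the positions inside the
      two cubes; returning from \<open>p\<close> to \<open>n\<close> costs a factor 3, whence
      6.\<close>
    from this[of s] this[of t] have "\<bar>(peano_curve cyclic s - peano_curve cyclic t) $ i\<bar> \<le> 2 * (1 / 3 ^ p)"
      using adj by simp
    also have "\<dots> = 6 * (1 / 3 ^ n)"
      by (simp add: p)
    finally show ?thesis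
      using scale by linarith
  qed
  \<comment> \<open>Bounding the Euclidean norm by the sum of the absolute coordinates contributes
    the factor \<open>CARD('d)\<close>.\<close>
  have "(\<Sum>i\<in>(UNIV :: 'd set). \<bar>(peano_curve cyclic s - peano_curve cyclic t) $ i\<bar>)
      \<le> of_nat (card (UNIV :: 'd set)) * (6 * (t - s) powr (1 / d))"
    by (rule sum_bounded_above) (rule coord)
  then show ?thesis
    using norm_le_l1_cart[of "peano_curve cyclic s - peano_curve cyclic t :: real ^ 'd"]
    by (simp add: dist_norm d_def mult_ac)
qed

lemma peano_curve_holder:
  assumes "s \<in> {0..1}" "t \<in> {0..1}"
  shows "dist (peano_curve cyclic s) (peano_curve cyclic t :: real ^ 'd::finite)
    \<le> 6 * CARD('d) * dist s t powr (1 / CARD('d))"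
proof (cases s t rule: linorder_cases)
  case less
  then show ?thesis
    using peano_curve_holder_aux[of s t, where 'd='d] assms by (simp add: dist_real_def)
next
  case greater
  then show ?thesis
    using peano_curve_holder_aux[of t s, where 'd='d] assms by (simp add: dist_real_def dist_commute)
qed simp

lemma measurable_peano_point_cell:
  "(\<lambda>t. peano_point c m (cell m t)) \<in> borel_measurable unit_interval"
  unfolding unit_interval_def by (rule measurable_restrict_space1) measurable

lemma measurable_peano_curve:
  "peano_curve cyclic \<in> measurable unit_interval unit_cube"
proof -
  have "peano_curve cyclic \<in> measurable unit_interval (lborel :: (real ^ 'a) measure)"
    using borel_measurable_LIMSEQ_metric[OF measurable_peano_point_cell
        peano_point_tendsto[OF filterlim_depth_cyclic]]
    by simp
  then show ?thesis
    using peano_curve_cyclic_in_cube unfolding unit_cube_def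
    by (intro measurable_restrict_space2) (auto simp: space_unit_cube)
qed

text \<open>Along \<open>m = CARD('d) * n\<close> the approximations have the law of
  \<open>grid_point n\<close>. The former converge to the curve, the latter to the identity, so the
  limits have equal laws.\<close>

lemma distr_peano_curve:
  "distr unit_interval unit_cube (peano_curve cyclic) = (unit_cube :: (real ^ 'd::finite) measure)"
proof (rule measure_eqI)
  let ?N = "unit_cube :: (real ^ 'd) measure" and ?\<phi> = "peano_curve cyclic :: real \<Rightarrow> real ^ 'd"
  let ?d = "CARD('d)"
  have id: "(\<lambda>x. x) \<in> borel_measurable ?N"
    unfolding unit_cube_def by (rule measurable_restrict_space1) simp
  have "filterlim (\<lambda>n. ?d * n) at_top sequentially"
    by (rule filterlim_subseq) (simp add: strict_mono_def)
  then have "(\<lambda>n. peano_point cyclic (?d * n) (cell (?d * n) t)) \<longlonglongrightarrow> ?\<phi> t" for t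
    using filterlim_compose[OF peano_point_tendsto[OF filterlim_depth_cyclic]] by blast
  then have *: "distr unit_interval borel ?\<phi> = distr ?N borel (\<lambda>x. x)"
    by (intro distr_eq_of_tendsto[OF prob_space_unit_interval prob_space_unit_cube
        measurable_peano_point_cell measurable_compose[OF id measurable_grid_point]
        distr_peano_point _ grid_point_tendsto])
  have \<phi>: "?\<phi> \<in> borel_measurable unit_interval"
    using measurable_compose[OF measurable_peano_curve id] .
  fix A assume "A \<in> sets (distr unit_interval ?N ?\<phi>)"
  then have A: "A \<in> sets ?N" by simp
  \<comment> \<open>The cube is Borel, so its measurable subsets are Borel and the equality of laws
    on the whole space applies to them.\<close>
  then have borel: "A \<in> sets borel"
    unfolding unit_cube_def by (subst (asm) sets_restrict_space_iff) auto
  have "emeasure (distr unit_interval borel ?\<phi>) A = emeasure (distr ?N borel (\<lambda>x. x)) A"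
    by (simp add: *)
  then show "emeasure (distr unit_interval ?N ?\<phi>) A = emeasure ?N A"
    using A borel \<phi> id emeasure_distr[OF measurable_peano_curve A] sets.sets_into_space[OF A]
    by (simp add: emeasure_distr Int_absorb2)
qed simp

section \<open>Pulling back graphons\<close>

text \<open>A change of variables at every vertex: a finite power of an image measure is the image
  of the power under the coordinatewise map \<open>compose V f\<close>.\<close>

lemma hom_density_distr:
  assumes "prob_space M" and f[measurable]: "f \<in> measurable M N"
    and W[measurable]: "W \<in> borel_measurable (N \<Otimes>\<^sub>M N)"
    and "finite_simple_graph V E"
  shows "hom_density V E (distr M N f) W = hom_density V E M (\<lambda>(x, y). W (f x, f y))"
proof -
  have E: "Min e \<in> V" "Max e \<in> V" if "e \<in> E" for e
  proof -
    have "e \<subseteq> V" "card e = 2"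
      using assms(4) that by (auto simp: finite_simple_graph_def)
    then have "finite e" "e \<noteq> {}"
      using card.infinite by force+
    then show "Min e \<in> V" "Max e \<in> V"
      using \<open>e \<subseteq> V\<close> Min_in Max_in by blast+
  qed
  have "finite V"
    using assms(4) by (simp add: finite_simple_graph_def)
  interpret M: prob_space M by fact
  let ?D = "distr M N f"
  have D: "prob_space ?D"
    by (rule M.prob_space_distr) (rule f)
  have PiM: "(\<Pi>\<^sub>M i\<in>V. ?D) = distr (\<Pi>\<^sub>M i\<in>V. M) (\<Pi>\<^sub>M i\<in>V. ?D) (compose V f)"
  proof -
    have "distr M ?D f = ?D"
      by (rule distr_cong) simp_all
    with distr_PiM_finite_prob_space'[of V "\<lambda>_. M" "\<lambda>_. ?D" f] show ?thesis
      using \<open>finite V\<close> D assms(1) by simp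
  qed
  have [measurable]: "compose V f \<in> measurable (\<Pi>\<^sub>M i\<in>V. M) (\<Pi>\<^sub>M i\<in>V. ?D)"
    unfolding compose_def by measurable
  have [measurable]: "(\<lambda>x. W (x (Min e), x (Max e))) \<in> borel_measurable (\<Pi>\<^sub>M i\<in>V. ?D)"
    if "e \<in> E" for e
  proof -
    have [measurable]: "W \<in> borel_measurable (?D \<Otimes>\<^sub>M ?D)"
      using W by (simp cong: measurable_cong_sets sets_pair_measure_cong)
    show ?thesis
      using E[OF that] by measurable
  qed
  have "hom_density V E ?D W =
      (\<integral>x. (\<Prod>e\<in>E. W (x (Min e), x (Max e))) \<partial>distr (\<Pi>\<^sub>M i\<in>V. M) (\<Pi>\<^sub>M i\<in>V. ?D) (compose V f))"
    unfolding hom_density_def 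
    using arg_cong[OF PiM, of "\<lambda>L. \<integral>x. (\<Prod>e\<in>E. W (x (Min e), x (Max e))) \<partial>L"] .
  also have "\<dots> = (\<integral>x. (\<Prod>e\<in>E. W (f (x (Min e)), f (x (Max e)))) \<partial>(\<Pi>\<^sub>M i\<in>V. M))"
    by (subst integral_distr) (auto simp: compose_eq E)
  finally show ?thesis
    by (simp add: hom_density_def)
qed

lemma graphon_pullback:
  assumes "graphon N W" "prob_space M" and [measurable]: "f \<in> measurable M N"
  shows "graphon M (\<lambda>(x, y). W (f x, f y))"
proof -
  have [measurable]: "W \<in> borel_measurable (N \<Otimes>\<^sub>M N)"
    using assms(1) by (simp add: graphon_def)
  have "f x \<in> space N" if "x \<in> space M" for x
    using that assms(3) by (rule measurable_space[rotated])
  then show ?thesis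
    using assms(1,2) by (auto simp: graphon_def)
qed

text \<open>The distance of two image pairs is at most the sum of the distances of their components,
  each at most \<open>\<bar>K\<bar> * r powr \<beta>\<close> with \<open>r\<close> the distance of
  the original pairs; raising to the power \<alpha> multiplies the exponents.\<close>

lemma holder_on_pullback:
  fixes f :: "'a::euclidean_space \<Rightarrow> 'b::euclidean_space"
  assumes "holder_on \<alpha> (D \<times> D) W" "0 < \<alpha>" "0 < \<beta>"
    and f: "\<And>x. x \<in> S \<Longrightarrow> f x \<in> D"
      "\<And>x y. x \<in> S \<Longrightarrow> y \<in> S \<Longrightarrow> dist (f x) (f y) \<le> K * dist x y powr \<beta>"
  shows "holder_on (\<alpha> * \<beta>) (S \<times> S) (\<lambda>(x, y). W (f x, f y))"
proof -
  obtain C where C: "\<And>u v. u \<in> D \<times> D \<Longrightarrow> v \<in> D \<times> D \<Longrightarrow> \<bar>W u - W v\<bar> \<le> C * dist u v powr \<alpha>"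
    using assms(1) unfolding holder_on_def by blast
  \<comment> \<open>Absolute values appear because the signs of \<open>C\<close> and
    \<open>K\<close> are not prescribed.\<close>
  have "\<bar>W (f x, f y) - W (f x', f y')\<bar> \<le>
      \<bar>C\<bar> * (2 * \<bar>K\<bar>) powr \<alpha> * dist (x, y) (x', y') powr (\<alpha> * \<beta>)"
    if S: "x \<in> S" "y \<in> S" "x' \<in> S" "y' \<in> S" for x y x' y'
  proof -
    let ?r = "dist (x, y) (x', y')"
    have le: "dist (f u) (f v) \<le> \<bar>K\<bar> * ?r powr \<beta>" if "u \<in> S" "v \<in> S" "dist u v \<le> ?r" for u v
    proof -
      have "dist (f u) (f v) \<le> K * dist u v powr \<beta>"
        using f(2) that by blast
      also have "\<dots> \<le> \<bar>K\<bar> * ?r powr \<beta>"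
        using that \<open>0 < \<beta>\<close> by (intro mult_mono powr_mono2) auto
      finally show ?thesis .
    qed
    have "dist (f x, f y) (f x', f y') \<le> dist (f x) (f x') + dist (f y) (f y')"
      by (simp add: dist_Pair_Pair sqrt_sum_squares_le_sum)
    also have "\<dots> \<le> \<bar>K\<bar> * ?r powr \<beta> + \<bar>K\<bar> * ?r powr \<beta>"
      using S dist_fst_le[of "(x, y)" "(x', y')"] dist_snd_le[of "(x, y)" "(x', y')"]
      by (intro add_mono le) auto
    finally have "dist (f x, f y) (f x', f y') \<le> 2 * \<bar>K\<bar> * ?r powr \<beta>"
      by simp
    then have "dist (f x, f y) (f x', f y') powr \<alpha> \<le> (2 * \<bar>K\<bar> * ?r powr \<beta>) powr \<alpha>"
      using \<open>0 < \<alpha>\<close> by (intro powr_mono2) auto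
    also have "\<dots> = (2 * \<bar>K\<bar>) powr \<alpha> * ?r powr (\<alpha> * \<beta>)"
      by (simp add: powr_mult powr_powr mult.commute)
    finally have "\<bar>C\<bar> * dist (f x, f y) (f x', f y') powr \<alpha> \<le>
        \<bar>C\<bar> * ((2 * \<bar>K\<bar>) powr \<alpha> * ?r powr (\<alpha> * \<beta>))"
      by (rule mult_left_mono) simp
    moreover have "\<bar>W (f x, f y) - W (f x', f y')\<bar> \<le> C * dist (f x, f y) (f x', f y') powr \<alpha>"
      using S f(1) by (intro C) auto
    moreover have "\<dots> \<le> \<bar>C\<bar> * dist (f x, f y) (f x', f y') powr \<alpha>"
      by (intro mult_right_mono) auto
    ultimately show ?thesis
      by (simp add: mult.assoc)
  qed
  then show ?thesis
    unfolding holder_on_def by (intro exI[of _ "\<bar>C\<bar> * (2 * \<bar>K\<bar>) powr \<alpha>"]) auto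
qed

section \<open>Differentiable graphons and the transfer from the cube to the interval\<close>

lemma convex_unit_cube: "convex (space unit_cube :: (real ^ 'd) set)"
proof -
  have "space unit_cube = (cbox 0 1 :: (real ^ 'd) set)"
    by (auto simp: space_unit_cube mem_box_cart)
  then show ?thesis
    by simp
qed

text \<open>The mean value inequality on a convex set; \<open>\<bar>B\<bar>\<close> is taken since a
  Lipschitz constant must be nonnegative.\<close>

lemma boundedly_differentiable_on_imp_holder:
  assumes "boundedly_differentiable_on D f" "convex D"
  shows "holder_on 1 D f"
proof -
  obtain f' B where f': "\<And>x. x \<in> D \<Longrightarrow> (f has_derivative f' x) (at x within D)"
    and B: "\<And>x. x \<in> D \<Longrightarrow> onorm (f' x) \<le> B"
    using assms(1) by (auto simp: boundedly_differentiable_on_def)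
  have "\<bar>B\<bar>-lipschitz_on D f"
    using f' assms(2) by (rule bounded_derivative_imp_lipschitz) (use B in force)+
  then show ?thesis
    by (auto simp: holder_on_1_iff_lipschitz)
qed

text \<open>The witness is the pullback along the Peano curve: measure preservation gives the
  equivalence, and the exponent \<open>1 / CARD('d)\<close> of the curve multiplies
  \<alpha>.\<close>

lemma holder_graphon_on_unit_interval:
  fixes W :: "(real ^ 'd) \<times> (real ^ 'd) \<Rightarrow> real"
  assumes W: "graphon unit_cube W"
    and "0 < \<alpha>" "holder_on \<alpha> (space unit_cube \<times> space unit_cube) W"
  shows "\<exists>V. graphon unit_interval V \<and> graphon_equivalent unit_interval V unit_cube W \<and>
    holder_on (\<alpha> / real CARD('d)) ({0..1} \<times> {0..1}) V"
proof (intro exI conjI)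
  let ?V = "\<lambda>(x, y). W (peano_curve cyclic x, peano_curve cyclic y)"
  show "graphon unit_interval ?V"
    by (rule graphon_pullback[OF W prob_space_unit_interval measurable_peano_curve])
  have "W \<in> borel_measurable (unit_cube \<Otimes>\<^sub>M unit_cube)"
    using W by (simp add: graphon_def)
  then show "graphon_equivalent unit_interval ?V unit_cube W"
    using hom_density_distr[OF prob_space_unit_interval measurable_peano_curve, where W = W]
    by (simp add: graphon_equivalent_def distr_peano_curve)
  have "holder_on (\<alpha> * (1 / CARD('d))) ({0..1} \<times> {0..1}) ?V"
    using assms(3,2)
  proof (rule holder_on_pullback)
    show "dist (peano_curve cyclic s) (peano_curve cyclic t :: real ^ 'd)
        \<le> 6 * CARD('d) * dist s t powr (1 / CARD('d))" if "s \<in> {0..1}" "t \<in> {0..1}" for s t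
      using that by (rule peano_curve_holder)
  qed (auto simp: peano_curve_cyclic_in_cube)
  then show "holder_on (\<alpha> / real CARD('d)) ({0..1} \<times> {0..1}) ?V"
    by simp
qed

theorem theorem2p1:
  fixes W :: "(real ^ 'd) \<times> (real ^ 'd) \<Rightarrow> real"
  assumes d: "CARD('d) \<ge> 2"
    and W: "graphon unit_cube W"
  shows
    "(\<forall>\<alpha>. 0 < \<alpha> \<and> \<alpha> \<le> 1 \<and> holder_on \<alpha> (space unit_cube \<times> space unit_cube) W \<longrightarrow>
        (\<exists>V. graphon unit_interval V \<and>
             graphon_equivalent unit_interval V unit_cube W \<and>
             holder_on (\<alpha> / real CARD('d)) ({0..1} \<times> {0..1}) V)) \<and>
     (boundedly_differentiable_on (space unit_cube \<times> space unit_cube) W \<or>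
      (\<exists>L. L-lipschitz_on (space unit_cube \<times> space unit_cube) W) \<longrightarrow>
        (\<exists>V. graphon unit_interval V \<and>
             graphon_equivalent unit_interval V unit_cube W \<and>
             holder_on (1 / real CARD('d)) ({0..1} \<times> {0..1}) V))"
proof (intro conjI allI impI)
  show "\<exists>V. graphon unit_interval V \<and> graphon_equivalent unit_interval V unit_cube W \<and>
      holder_on (\<alpha> / real CARD('d)) ({0..1} \<times> {0..1}) V"
    if "0 < \<alpha> \<and> \<alpha> \<le> 1 \<and> holder_on \<alpha> (space unit_cube \<times> space unit_cube) W" for \<alpha>
    using that by (intro holder_graphon_on_unit_interval[OF W]) auto
  assume "boundedly_differentiable_on (space unit_cube \<times> space unit_cube) W \<or>
    (\<exists>L. L-lipschitz_on (space unit_cube \<times> space unit_cube) W)"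
  \<comment> \<open>Both alternatives reduce to exponent 1, the differentiable one by convexity of
    the product of the cubes.\<close>
  then have "holder_on 1 (space unit_cube \<times> space unit_cube) W"
    using boundedly_differentiable_on_imp_holder[OF _ convex_Times[OF convex_unit_cube convex_unit_cube]]
    by (auto simp: holder_on_1_iff_lipschitz)
  then show "\<exists>V. graphon unit_interval V \<and> graphon_equivalent unit_interval V unit_cube W \<and>
      holder_on (1 / real CARD('d)) ({0..1} \<times> {0..1}) V"
    by (intro holder_graphon_on_unit_interval[OF W]) auto
qed

end
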